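(* Let $X$ be a metric space, and let $\mathcal{O}$ be the collection of all open covers of $X$. (1) If $X$ is countable dimensional, then player TWO has a winning strategy in the game $\mathsf{G}_c^{\omega}(\mathcal{O},\mathcal{O})$. (2) If player TWO has a winning strategy in the game $\mathsf{G}_c^{\omega}(\mathcal{O},\mathcal{O})$, then $X$ is countable dimensional.
   Context: A family $\mathcal{V}$ of sets refines a family $\mathcal{U}$ if every element of $\mathcal{V}$ is a subset of some element of $\mathcal{U}$ ($\mathcal{V}$ need not cover $X$). For families $\mathcal{A},\mathcal{B}$ of collections of subsets of $X$ and an ordinal $k$, the game $\mathsf{G}_c^{k}(\mathcal{A},\mathcal{B})$ between players ONE and TWO is as follows: there is one inning for each $l<k$; in the $l$-th inning ONE first chooses $\mathcal{O}_l\in\mathcal{A}$, and then TWO responds with a family $\mathcal{T}_l$ of pairwise disjoint sets which refines $\mathcal{O}_l$. The play is won by TWO if $\bigcup_{l<k}\mathcal{T}_l$ is a member of $\mathcal{B}$; otherwise ONE wins. (So when $\mathcal{B}=\mathcal{O}$, TWO wins exactly when $\bigcup_{l<k}\mathcal{T}_l$ consists of open sets and covers $X$.) A metric space is countable dimensional if it is the union of countably many zero-dimensional subspaces, where dimension is covering dimension. *)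

theory Defs
  imports "HOL-Analysis.Analysis"
begin

text \<open>A refinement need not cover anything.\<close>

definition refines :: "'a set set \<Rightarrow> 'a set set \<Rightarrow> bool" where
  "refines \<V> \<U> \<longleftrightarrow> (\<forall>V\<in>\<V>. \<exists>U\<in>\<U>. V \<subseteq> U)"

definition open_covers :: "'a topology \<Rightarrow> 'a set set set" where
  "open_covers X = {\<U>. (\<forall>U\<in>\<U>. openin X U) \<and> \<Union>\<U> = topspace X}"


text \<open>
  Lebesgue covering dimension at most \<open>n\<close>, in its form for finite open covers: each finite
  open cover has a finite open cover refining it in which no point lies in more than \<open>n + 1\<close>
  members.  The bound is an integer so that \<open>n = -1\<close>, which characterises the empty
  space, is included.
\<close>

definition covering_dim_le :: "'a topology \<Rightarrow> int \<Rightarrow> bool" where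
  "covering_dim_le X n \<longleftrightarrow>
     (\<forall>\<U>\<in>open_covers X. finite \<U> \<longrightarrow>
        (\<exists>\<V>\<in>open_covers X. finite \<V> \<and> refines \<V> \<U> \<and>
           (\<forall>x\<in>topspace X. int (card {V \<in> \<V>. x \<in> V}) \<le> n + 1)))"

definition zero_dimensional :: "'a topology \<Rightarrow> bool" where
  "zero_dimensional X \<longleftrightarrow> covering_dim_le X 0 \<and> \<not> covering_dim_le X (- 1)"

text \<open>
  The countable family may be finite or empty; in particular the empty space is countable
  dimensional although it is not zero-dimensional.
\<close>

definition countable_dimensional :: "'a topology \<Rightarrow> bool" where
  "countable_dimensional X \<longleftrightarrow>
     (\<exists>\<Z>. countable \<Z> \<and> (\<forall>Z\<in>\<Z>. Z \<subseteq> topspace X \<and> zero_dimensional (subtopology X Z)) \<and>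
          \<Union>\<Z> = topspace X)"


text \<open>
  The game \<open>G\<^sub>c\<^sup>\<omega>(\<A>, \<B>)\<close>.  In inning \<open>l\<close> ONE plays \<open>\<O> l\<close> and TWO
  answers \<open>\<T> l\<close>.
\<close>

definition Gc_legal_response :: "'a set set \<Rightarrow> 'a set set \<Rightarrow> bool" where
  "Gc_legal_response \<U> \<T> \<longleftrightarrow> pairwise disjnt \<T> \<and> refines \<T> \<U>"

definition Gc_won_by_TWO :: "'a set set set \<Rightarrow> (nat \<Rightarrow> 'a set set) \<Rightarrow> bool" where
  "Gc_won_by_TWO \<B> \<T> \<longleftrightarrow> (\<Union>l. \<T> l) \<in> \<B>"

text \<open>
  A strategy for TWO maps the list of ONE's moves up to and including the current inning to
  TWO's answer; TWO's own earlier moves are determined by these and the strategy.  A winning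
  strategy gives legal answers and wins against every sequence of legal moves of ONE.
\<close>

definition Gc_winning_strategy_TWO ::
  "'a set set set \<Rightarrow> 'a set set set \<Rightarrow> ('a set set list \<Rightarrow> 'a set set) \<Rightarrow> bool" where
  "Gc_winning_strategy_TWO \<A> \<B> \<sigma> \<longleftrightarrow>
     (\<forall>\<O> :: nat \<Rightarrow> 'a set set. (\<forall>l. \<O> l \<in> \<A>) \<longrightarrow>
        (let \<T> = (\<lambda>l. \<sigma> (map \<O> [0..<Suc l])) in
           (\<forall>l. Gc_legal_response (\<O> l) (\<T> l)) \<and> Gc_won_by_TWO \<B> \<T>))"

definition TWO_has_winning_strategy_Gc :: "'a set set set \<Rightarrow> 'a set set set \<Rightarrow> bool" where
  "TWO_has_winning_strategy_Gc \<A> \<B> \<longleftrightarrow> (\<exists>\<sigma>. Gc_winning_strategy_TWO \<A> \<B> \<sigma>)"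

end

theory Submission
  imports Defs
begin

text \<open>
  If \<open>X\<close> is the union of the zero-dimensional sets \<open>Z n\<close>, then TWO covers \<open>Z n\<close> in inning \<open>n\<close>: every
  open cover of a zero-dimensional metric space has a disjoint open refinement, and a disjoint
  family of relatively open sets of a subspace expands to a disjoint family of open sets.
  No separability is available, so the first fact is obtained from Stone's construction: each open
  cover is refined by countably many uniformly discrete families, and clopen sets make their
  members disjoint across different families.

  Conversely, let \<open>\<sigma>\<close> be winning and let ONE play only the covers \<open>B n\<close> by balls of radius
  \<open>1 / (n + 1)\<close>.  For a finite sequence \<open>s\<close> of indices let \<open>C s\<close> be the set of points which, after
  ONE has played along \<open>s\<close>, are covered by TWO's answer to each \<open>B n\<close>.  Each \<open>C s\<close> has disjoint
  open covers of arbitrarily small mesh and hence dimension zero; and a point outside all \<open>C s\<close>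
  would allow ONE to win.
\<close>

section \<open>Dimension zero, clopen separation and disjoint open refinements\<close>

text \<open>Refine the cover by \<open>G\<close> and the complement of \<open>F\<close> so that no
  point lies in two members. Members meeting \<open>F\<close> cannot lie in that complement, so they
  lie in \<open>G\<close>; their union is clopen because the remaining members make up the rest of
  the space.\<close>

lemma covering_dim_le_0_clopen_between:
  assumes "covering_dim_le X 0" "closedin X F" "openin X G" "F \<subseteq> G"
  obtains C where "openin X C" "closedin X C" "F \<subseteq> C" "C \<subseteq> G"
proof -
  have FX: "F \<subseteq> topspace X" and GX: "G \<subseteq> topspace X"
    using assms(2,3) by (auto dest: closedin_subset openin_subset)
  have "{G, topspace X - F} \<in> open_covers X"
    using assms GX by (auto simp: open_covers_def)
  then obtain \<V> where \<V>: "\<V> \<in> open_covers X" "finite \<V>" "refines \<V> {G, topspace X - F}"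
    and card: "\<And>x. x \<in> topspace X \<Longrightarrow> card {V \<in> \<V>. x \<in> V} \<le> 1"
    using assms(1) unfolding covering_dim_le_def by fastforce
  have op: "openin X V" if "V \<in> \<V>" for V using \<V>(1) that by (auto simp: open_covers_def)
  have cov: "\<Union>\<V> = topspace X" using \<V>(1) by (auto simp: open_covers_def)
  have same: "V = W" if "V \<in> \<V>" "W \<in> \<V>" "x \<in> V" "x \<in> W" for V W x
  proof -
    have "card {V \<in> \<V>. x \<in> V} \<le> Suc 0" using card[of x] cov that by auto
    then show ?thesis using that \<V>(2) by (simp add: card_le_Suc0_iff_eq)
  qed
  define C where "C = \<Union>{V \<in> \<V>. V \<inter> F \<noteq> {}}"
  have eq: "topspace X - C = \<Union>{V \<in> \<V>. V \<inter> F = {}}"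
    unfolding C_def using cov same by fast
  show thesis
  proof
    show "openin X C" using op by (auto simp: C_def)
    have "openin X (topspace X - C)" unfolding eq using op by auto
    then show "closedin X C" using cov by (auto simp: closedin_def C_def)
    show "F \<subseteq> C" using FX cov unfolding C_def by blast
    show "C \<subseteq> G" using \<V>(3) by (fastforce simp: C_def refines_def)
  qed
qed

context Metric_space
begin

text \<open>For fixed \<open>n\<close> the Stone sets \<open>G n U\<close> are already disjoint, so
  only different levels can overlap. Dimension zero puts a clopen set between the cores
  \<open>F n U\<close> and their enlargements \<open>G n U\<close>; subtracting the earlier clopen
  sets separates the levels and keeps everything open.\<close>

lemma disjoint_open_refinement:
  assumes dim: "covering_dim_le mtopology 0" and \<U>: "\<U> \<in> open_covers mtopology"
  obtains \<V> where "\<V> \<in> open_covers mtopology" "pairwise disjnt \<V>" "refines \<V> \<U>"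
proof -
  have op: "openin mtopology U" if "U \<in> \<U>" for U using \<U> that by (auto simp: open_covers_def)
  have cov: "\<Union>\<U> = M" using \<U> by (auto simp: open_covers_def)
  \<comment> \<open>Well-ordering all sets of points supplies a least member of \<open>\<U>\<close>
    through each point.\<close>
  obtain r :: "'a set rel" where wo: "well_order_on UNIV r"
    using well_order_on[of UNIV] by blast
  define lt where "lt = r - Id"
  have wf: "wf lt" using wo by (simp add: well_order_on_def lt_def)
  have tot: "(U, W) \<in> lt \<or> (W, U) \<in> lt" if "U \<noteq> W" for U W
    using wo that by (auto simp: well_order_on_def linear_order_on_def total_on_def lt_def)
  define \<rho> where "\<rho> n = inverse (real (Suc n))" for n
  \<comment> \<open>If \<open>(U, W) \<in> lt\<close>, points of \<open>F n U\<close> and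
    \<open>F n W\<close> are at least \<open>\<rho> n\<close> apart: the latter avoids
    \<open>U\<close>, which contains the \<open>\<rho> n\<close>-ball about the former. Half that
    radius in \<open>G\<close> therefore keeps the enlargements disjoint.\<close>
  define F where "F n U = {x \<in> M. mball x (\<rho> n) \<subseteq> U \<and> (\<forall>W\<in>\<U>. (W, U) \<in> lt \<longrightarrow> x \<notin> W)}" for n U
  define G where "G n U = (\<Union>x\<in>F n U. mball x (\<rho> n / 2))" for n U
  have \<rho>: "\<rho> n > 0" for n by (simp add: \<rho>_def)
  have G_open: "openin mtopology (G n U)" for n U by (auto simp: G_def)
  have G_sub: "G n U \<subseteq> U" for n U
  proof -
    have "mball x (\<rho> n / 2) \<subseteq> U" if "x \<in> F n U" for x
      using that mball_subset_concentric[of "\<rho> n / 2" "\<rho> n" x] \<rho>[of n] by (auto simp: F_def)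
    then show ?thesis by (auto simp: G_def)
  qed
  have G_disj0: False
    if "U \<in> \<U>" "W \<in> \<U>" "(U, W) \<in> lt" "y \<in> G n U" "y \<in> G n W" for U W n y
  proof -
    obtain x z where x: "x \<in> F n U" "y \<in> mball x (\<rho> n / 2)" and z: "z \<in> F n W" "y \<in> mball z (\<rho> n / 2)"
      using \<open>y \<in> G n U\<close> \<open>y \<in> G n W\<close> by (auto simp: G_def)
    have "d x z < \<rho> n"
      using x z triangle[of x y z] commute[of y z] by auto
    then have "z \<in> mball x (\<rho> n)" using x z by auto
    then have "z \<in> U" using x(1) by (auto simp: F_def)
    then show False using z(1) that by (auto simp: F_def)
  qed
  have G_disj: "disjnt (G n U) (G n W)" if "U \<in> \<U>" "W \<in> \<U>" "U \<noteq> W" for n U W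
    using G_disj0[of U W] G_disj0[of W U] tot[OF that(3)] that by (auto simp: disjnt_iff)
  have "\<exists>C. openin mtopology C \<and> closedin mtopology C \<and> (\<Union>U\<in>\<U>. F n U) \<subseteq> C \<and> C \<subseteq> (\<Union>U\<in>\<U>. G n U)" for n
  proof -
    let ?F = "\<Union>U\<in>\<U>. F n U" and ?G = "\<Union>U\<in>\<U>. G n U"
    have sub: "?F \<subseteq> mtopology closure_of ?F"
      by (rule closure_of_subset) (auto simp: F_def)
    \<comment> \<open>Clopen separation needs a closed inner set. A point of the closure is within
      \<open>\<rho> n / 2\<close> of some core point, so the closure stays inside
      \<open>?G\<close>.\<close>
    have "mtopology closure_of ?F \<subseteq> ?G"
    proof
      fix y assume "y \<in> mtopology closure_of ?F"
      then obtain x where "x \<in> ?F" "x \<in> mball y (\<rho> n / 2)"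
        unfolding metric_closure_of using half_gt_zero[OF \<rho>[of n]] by blast
      then show "y \<in> ?G" by (auto simp: G_def commute)
    qed
    moreover have "openin mtopology ?G" using G_open by (intro openin_Union) auto
    ultimately obtain C where "openin mtopology C" "closedin mtopology C" "mtopology closure_of ?F \<subseteq> C" "C \<subseteq> ?G"
      using covering_dim_le_0_clopen_between[OF dim closedin_closure_of] by metis
    then show ?thesis using sub by (meson order_trans)
  qed
  then obtain C where C: "\<And>n. openin mtopology (C n)" "\<And>n. closedin mtopology (C n)"
    "\<And>n. (\<Union>U\<in>\<U>. F n U) \<subseteq> C n" "\<And>n. C n \<subseteq> (\<Union>U\<in>\<U>. G n U)"
    by metis
  define D where "D n = C n - (\<Union>m<n. C m)" for n
  have D_open: "openin mtopology (D n)" for n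
    unfolding D_def using C by (intro openin_diff closedin_Union) auto
  have D_disj: "disjnt (D m) (D n)" if "m \<noteq> n" for m n
    using that by (cases m n rule: linorder_cases) (auto simp: D_def disjnt_iff)
  define \<V> where "\<V> = {D n \<inter> G n U | n U. U \<in> \<U>}"
  have cover: "\<exists>n. \<exists>U\<in>\<U>. x \<in> D n \<inter> G n U" if "x \<in> M" for x
  proof -
    have "{U \<in> \<U>. x \<in> U} \<noteq> {}" using cov that by auto
    then obtain U where "U \<in> {U \<in> \<U>. x \<in> U}" and min: "\<And>W. (W, U) \<in> lt \<Longrightarrow> W \<notin> {U \<in> \<U>. x \<in> U}"
      by (rule wfE_min'[OF wf]) blast
    then have U: "U \<in> \<U>" "x \<in> U" by auto
    obtain e where e: "e > 0" "mball x e \<subseteq> U"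
      using op[OF U(1)] U(2) by (auto simp: openin_mtopology)
    obtain k where k: "\<rho> k < e"
      using reals_Archimedean[OF e(1)] by (auto simp: \<rho>_def)
    have "x \<in> F k U"
      using mball_subset_concentric[of "\<rho> k" e x] k e min that by (auto simp: F_def)
    then have ex: "x \<in> C k" using C(3) U(1) by blast
    \<comment> \<open>The least index puts \<open>x\<close> in \<open>D n\<close>. The member
      \<open>W\<close> found at this level may differ from \<open>U\<close>, whose purpose was to
      show that some \<open>C k\<close> contains \<open>x\<close>.\<close>
    define n where "n = (LEAST n. x \<in> C n)"
    have "x \<in> D n"
      unfolding D_def n_def using LeastI[of "\<lambda>n. x \<in> C n", OF ex] not_less_Least by blast
    then have "x \<in> C n" by (simp add: D_def)
    then obtain W where "W \<in> \<U>" "x \<in> G n W" using C(4) by blast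
    then show ?thesis using \<open>x \<in> D n\<close> by blast
  qed
  show thesis
  proof
    have "openin mtopology V" if "V \<in> \<V>" for V using that D_open G_open by (auto simp: \<V>_def)
    moreover have "\<Union>\<V> = M"
    proof
      show "\<Union>\<V> \<subseteq> M" using G_sub cov by (auto simp: \<V>_def)
      show "M \<subseteq> \<Union>\<V>" using cover unfolding \<V>_def by blast
    qed
    ultimately show "\<V> \<in> open_covers mtopology" by (simp add: open_covers_def)
    show "refines \<V> \<U>" using G_sub by (auto simp: \<V>_def refines_def)
    show "pairwise disjnt \<V>"
    proof (rule pairwiseI)
      fix V W assume "V \<in> \<V>" "W \<in> \<V>" "V \<noteq> W"
      then obtain m n S T where eq: "V = D m \<inter> G m S" "W = D n \<inter> G n T" "S \<in> \<U>" "T \<in> \<U>"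
        by (auto simp: \<V>_def)
      then have "m \<noteq> n \<or> m = n \<and> S \<noteq> T" using \<open>V \<noteq> W\<close> by auto
      then show "disjnt V W"
        using D_disj[of m n] G_disj[of S T m] eq by (auto simp: disjnt_iff)
    qed
  qed
qed

text \<open>Each point of a relatively open \<open>V\<close> gets a ball whose trace on
  \<open>Z\<close> stays in \<open>V\<close> and which itself stays in a chosen cover member
  \<open>u V\<close>. The first condition makes the half-radius expansions disjoint, the second
  makes them refine \<open>\<U>\<close>.\<close>

lemma disjoint_open_refinement_covering_subspace:
  assumes "Z \<subseteq> M" and dim: "covering_dim_le (subtopology mtopology Z) 0"
    and \<U>: "\<U> \<in> open_covers mtopology"
  obtains \<T> where "\<And>T. T \<in> \<T> \<Longrightarrow> openin mtopology T" "pairwise disjnt \<T>" "refines \<T> \<U>" "Z \<subseteq> \<Union>\<T>"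
proof -
  interpret S: Submetric M d Z using \<open>Z \<subseteq> M\<close> by unfold_locales
  have top: "S.sub.mtopology = subtopology mtopology Z" by (rule S.mtopology_submetric)
  have op: "openin mtopology U" if "U \<in> \<U>" for U using \<U> that by (auto simp: open_covers_def)
  have cov: "\<Union>\<U> = M" using \<U> by (auto simp: open_covers_def)
  have "(\<lambda>U. U \<inter> Z) ` \<U> \<in> open_covers S.sub.mtopology"
    using op cov \<open>Z \<subseteq> M\<close> unfolding top by (auto simp: open_covers_def openin_subtopology)
  then obtain \<V> where \<V>: "\<V> \<in> open_covers S.sub.mtopology" "pairwise disjnt \<V>"
    "refines \<V> ((\<lambda>U. U \<inter> Z) ` \<U>)"
    using S.sub.disjoint_open_refinement dim unfolding top by metis
  have "\<exists>U\<in>\<U>. V \<subseteq> U" if "V \<in> \<V>" for V using \<V>(3) that by (auto simp: refines_def)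
  then obtain u where u: "\<And>V. V \<in> \<V> \<Longrightarrow> u V \<in> \<U> \<and> V \<subseteq> u V" by metis
  have "\<exists>r>0. mball x r \<inter> Z \<subseteq> V \<and> mball x r \<subseteq> u V" if "V \<in> \<V>" "x \<in> V" for V x
  proof -
    have "openin (subtopology mtopology Z) V" using \<V>(1) that unfolding top by (auto simp: open_covers_def)
    then obtain W where W: "openin mtopology W" "V = W \<inter> Z" by (auto simp: openin_subtopology)
    have "openin mtopology (W \<inter> u V)" "x \<in> W \<inter> u V" using W op u that by auto
    then show ?thesis using W(2) by (fastforce simp: openin_mtopology)
  qed
  then obtain r where r: "\<And>V x. V \<in> \<V> \<Longrightarrow> x \<in> V \<Longrightarrow> r V x > 0 \<and> mball x (r V x) \<inter> Z \<subseteq> V \<and> mball x (r V x) \<subseteq> u V"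
    by metis
  define T where "T V = (\<Union>x\<in>V. mball x (r V x / 2))" for V
  have VZ: "V \<subseteq> Z" if "V \<in> \<V>" for V using \<V>(1) that by (auto simp: open_covers_def)
  \<comment> \<open>The larger of the two radii exceeds the distance of the centres, so the other centre
    lies in the larger ball.\<close>
  have disj: False if VW: "V \<in> \<V>" "W \<in> \<V>" "V \<noteq> W" and x: "x \<in> V" "y \<in> mball x (r V x / 2)"
    and z: "z \<in> W" "y \<in> mball z (r W z / 2)" and le: "r W z \<le> r V x" for V W x y z
  proof -
    have "d x z < r V x" using x z le triangle[of x y z] commute[of y z] by auto
    then have "z \<in> mball x (r V x) \<inter> Z" using x z VZ VW by auto
    then have "z \<in> V" using r[OF VW(1) x(1)] by auto
    then show False using pairwiseD[OF \<V>(2) VW] z(1) by (auto simp: disjnt_iff)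
  qed
  show thesis
  proof
    show "openin mtopology S" if "S \<in> T ` \<V>" for S using that by (auto simp: T_def)
    show "refines (T ` \<V>) \<U>"
    proof -
      have "T V \<subseteq> u V" if "V \<in> \<V>" for V
      proof -
        have "mball x (r V x / 2) \<subseteq> u V" if "x \<in> V" for x
          using r[OF \<open>V \<in> \<V>\<close> that] mball_subset_concentric[of "r V x / 2" "r V x" x] by auto
        then show ?thesis by (auto simp: T_def)
      qed
      then show ?thesis using u by (auto simp: refines_def)
    qed
    have "disjnt (T V) (T W)" if "V \<in> \<V>" "W \<in> \<V>" "V \<noteq> W" for V W
    proof -
      have False if "x \<in> V" "y \<in> mball x (r V x / 2)" "z \<in> W" "y \<in> mball z (r W z / 2)" for x y z
        using disj[of V W x y z] disj[of W V z y x] that \<open>V \<in> \<V>\<close> \<open>W \<in> \<V>\<close> \<open>V \<noteq> W\<close>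
        by (metis linorder_linear)
      then show ?thesis unfolding T_def disjnt_iff by blast
    qed
    then show "pairwise disjnt (T ` \<V>)" by (auto simp: pairwise_def)
    show "Z \<subseteq> \<Union>(T ` \<V>)"
    proof
      fix x assume "x \<in> Z"
      then obtain V where "V \<in> \<V>" "x \<in> V" using \<V>(1) \<open>Z \<subseteq> M\<close> by (auto simp: open_covers_def)
      then have "x \<in> mball x (r V x / 2)" using r[of V x] \<open>x \<in> Z\<close> \<open>Z \<subseteq> M\<close> by auto
      then show "x \<in> \<Union>(T ` \<V>)" using \<open>V \<in> \<V>\<close> \<open>x \<in> V\<close> by (auto simp: T_def)
    qed
  qed
qed

section \<open>Dimension zero from disjoint covers of small mesh\<close>

text \<open>Intersecting the first few covers gives nested open cells. Each point chooses a member
  of \<open>\<U>\<close> containing the first of its cells that fits into one. All points of that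
  cell choose alike, so the fibres of the choice are disjoint open sets indexed by the finite
  cover.\<close>

lemma covering_dim_le_0_if_fine_disjoint_open_covers:
  assumes "\<And>e. e > 0 \<Longrightarrow> \<exists>\<P>\<in>open_covers mtopology. pairwise disjnt \<P> \<and> (\<forall>P\<in>\<P>. \<forall>x\<in>P. \<forall>y\<in>P. d x y < e)"
  shows "covering_dim_le mtopology 0"
proof -
  have "\<forall>n. \<exists>\<P>. \<P> \<in> open_covers mtopology \<and> pairwise disjnt \<P> \<and>
      (\<forall>P\<in>\<P>. \<forall>x\<in>P. \<forall>y\<in>P. d x y < inverse (real (Suc n)))"
    using assms by (metis inverse_positive_iff_positive of_nat_0_less_iff zero_less_Suc)
  then obtain \<P> where \<P>: "\<And>n. \<P> n \<in> open_covers mtopology" "\<And>n. pairwise disjnt (\<P> n)"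
    "\<And>n P x y. P \<in> \<P> n \<Longrightarrow> x \<in> P \<Longrightarrow> y \<in> P \<Longrightarrow> d x y < inverse (real (Suc n))"
    by metis
  \<comment> \<open>By disjointness this union is the single member of \<open>\<P> n\<close> through
    \<open>x\<close>.\<close>
  define p where "p n x = \<Union>{P \<in> \<P> n. x \<in> P}" for n x
  have p_eq: "p n x = P" if "P \<in> \<P> n" "x \<in> P" for n x P
  proof -
    have "{P \<in> \<P> n. x \<in> P} = {P}" using \<P>(2)[of n] that by (auto simp: pairwise_def disjnt_iff)
    then show ?thesis by (simp add: p_def)
  qed
  have p_in: "p n x \<in> \<P> n" "x \<in> p n x" if "x \<in> M" for n x
    using \<P>(1)[of n] that p_eq by (force simp: open_covers_def)+
  have p_same: "p n y = p n x" if "x \<in> M" "y \<in> p n x" for n x y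
    using p_eq p_in that by blast
  have p_open: "openin mtopology (p n x)" if "x \<in> M" for n x
    using p_in[OF that] \<P>(1)[of n] by (auto simp: open_covers_def)
  \<comment> \<open>The given covers need not refine each other; the cells \<open>Q n x\<close> do.\<close>
  define Q where "Q n x = (\<Inter>m\<in>{..n}. p m x)" for n x
  have Q_open: "openin mtopology (Q n x)" if "x \<in> M" for n x
    unfolding Q_def using p_open[OF that] by (intro openin_INT2) auto
  have Q_refl: "x \<in> Q n x" if "x \<in> M" for n x using p_in that by (auto simp: Q_def)
  have Q_same: "Q m y = Q m x" if "x \<in> M" "y \<in> Q n x" "m \<le> n" for n m x y
    unfolding Q_def using p_same that by (intro INF_cong) (auto simp: Q_def)
  show ?thesis unfolding covering_dim_le_def
  proof (intro ballI impI)
    fix \<U> assume \<U>: "\<U> \<in> open_covers mtopology" "finite \<U>"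
    have ex: "\<exists>n. \<exists>U\<in>\<U>. Q n x \<subseteq> U" if x: "x \<in> M" for x
    proof -
      obtain U where U: "U \<in> \<U>" "x \<in> U" "openin mtopology U" using \<U>(1) x by (auto simp: open_covers_def)
      obtain e where e: "e > 0" "mball x e \<subseteq> U" using U by (auto simp: openin_mtopology)
      obtain n where n: "inverse (real (Suc n)) < e" using reals_Archimedean[OF e(1)] by auto
      have "Q n x \<subseteq> mball x e"
      proof
        fix y assume "y \<in> Q n x"
        then have "y \<in> p n x" "y \<in> M" using openin_subset[OF Q_open[OF x]] by (auto simp: Q_def)
        then show "y \<in> mball x e" using \<P>(3)[OF p_in(1)[OF x] p_in(2)[OF x], of y n] n x by auto
      qed
      then show ?thesis using e U by blast
    qed
    define N where "N x = (LEAST n. \<exists>U\<in>\<U>. Q n x \<subseteq> U)" for x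
    \<comment> \<open>The choice sees only the set \<open>Q (N x) x\<close>, so equal cells yield
      equal members.\<close>
    define h where "h x = (SOME U. U \<in> \<U> \<and> Q (N x) x \<subseteq> U)" for x
    have N: "\<exists>U\<in>\<U>. Q (N x) x \<subseteq> U" if "x \<in> M" for x
      unfolding N_def by (rule LeastI_ex) (rule ex[OF that])
    have h: "h x \<in> \<U>" "Q (N x) x \<subseteq> h x" if "x \<in> M" for x
      using someI_ex[of "\<lambda>U. U \<in> \<U> \<and> Q (N x) x \<subseteq> U"] N[OF that] by (auto simp: h_def)
    have h_same: "h y = h x" if x: "x \<in> M" and y: "y \<in> Q (N x) x" for x y
    proof -
      have "y \<in> M" using openin_subset[OF Q_open[OF x]] y by auto
      have eq: "Q m y = Q m x" if "m \<le> N x" for m using Q_same[OF x y that] .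
      \<comment> \<open>This bound comes first because \<open>eq\<close> holds only up to
        \<open>N x\<close>; it makes \<open>eq\<close> applicable at \<open>N y\<close> for the
        reverse bound.\<close>
      have "N y \<le> N x" unfolding N_def[of y] by (rule Least_le) (use eq N[OF x] in auto)
      moreover have "N x \<le> N y" unfolding N_def[of x]
        by (rule Least_le) (use eq \<open>N y \<le> N x\<close> N[OF \<open>y \<in> M\<close>] in auto)
      ultimately show ?thesis using eq by (simp add: h_def)
    qed
    define V where "V U = {x \<in> M. h x = U}" for U
    have "openin mtopology (V U)" for U
    proof (subst openin_subopen, intro ballI)
      fix x assume x: "x \<in> V U"
      then have "x \<in> M" by (simp add: V_def)
      have "Q (N x) x \<subseteq> V U"
        using x h_same[OF \<open>x \<in> M\<close>] openin_subset[OF Q_open[OF \<open>x \<in> M\<close>]] by (auto simp: V_def)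
      then show "\<exists>T. openin mtopology T \<and> x \<in> T \<and> T \<subseteq> V U"
        using Q_open[OF \<open>x \<in> M\<close>] Q_refl[OF \<open>x \<in> M\<close>] by blast
    qed
    moreover have "\<Union>(V ` \<U>) = M" using h by (auto simp: V_def)
    ultimately have "V ` \<U> \<in> open_covers mtopology" by (auto simp: open_covers_def)
    moreover have "V U \<subseteq> U" for U using h(2) Q_refl unfolding V_def by blast
    then have "refines (V ` \<U>) \<U>" by (auto simp: refines_def)
    moreover have "int (card {W \<in> V ` \<U>. x \<in> W}) \<le> 0 + 1" for x
    proof -
      have "{W \<in> V ` \<U>. x \<in> W} \<subseteq> {V (h x)}" by (auto simp: V_def)
      then have "card {W \<in> V ` \<U>. x \<in> W} \<le> card {V (h x)}" by (intro card_mono) auto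
      then show ?thesis by simp
    qed
    ultimately show "\<exists>\<V>\<in>open_covers mtopology. finite \<V> \<and> refines \<V> \<U> \<and>
        (\<forall>x\<in>topspace mtopology. int (card {V \<in> \<V>. x \<in> V}) \<le> 0 + 1)"
      using \<U>(2) by blast
  qed
qed

lemma covering_dim_le_0_subspace_if_fine_disjoint_open_families:
  assumes "Z \<subseteq> M"
    and "\<And>e. e > 0 \<Longrightarrow> \<exists>\<P>. (\<forall>P\<in>\<P>. openin mtopology P) \<and> Z \<subseteq> \<Union>\<P> \<and> pairwise disjnt \<P> \<and>
           (\<forall>P\<in>\<P>. \<forall>x\<in>P. \<forall>y\<in>P. d x y < e)"
  shows "covering_dim_le (subtopology mtopology Z) 0"
proof -
  interpret S: Submetric M d Z using \<open>Z \<subseteq> M\<close> by unfold_locales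
  have "covering_dim_le S.sub.mtopology 0"
  proof (rule S.sub.covering_dim_le_0_if_fine_disjoint_open_covers)
    fix e :: real assume "e > 0"
    then obtain \<P> where \<P>: "\<forall>P\<in>\<P>. openin mtopology P" "Z \<subseteq> \<Union>\<P>" "pairwise disjnt \<P>"
        "\<forall>P\<in>\<P>. \<forall>x\<in>P. \<forall>y\<in>P. d x y < e"
      using assms(2) by metis
    show "\<exists>\<P>\<in>open_covers S.sub.mtopology. pairwise disjnt \<P> \<and> (\<forall>P\<in>\<P>. \<forall>x\<in>P. \<forall>y\<in>P. d x y < e)"
    proof (intro bexI conjI)
      show "(\<lambda>P. P \<inter> Z) ` \<P> \<in> open_covers S.sub.mtopology"
        using \<P>(1,2) \<open>Z \<subseteq> M\<close> unfolding S.mtopology_submetric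
        by (auto simp: open_covers_def openin_subtopology)
      show "pairwise disjnt ((\<lambda>P. P \<inter> Z) ` \<P>)"
        using \<P>(3) unfolding pairwise_def disjnt_def by blast
    qed (use \<P>(4) in auto)
  qed
  then show ?thesis unfolding S.mtopology_submetric .
qed

end

text \<open>The order bound is then zero, so no member of a finite cover may contain a point. This
  identifies the case that \<open>zero_dimensional\<close> excludes.\<close>

lemma covering_dim_le_minus_one_iff: "covering_dim_le X (-1) \<longleftrightarrow> topspace X = {}"
proof
  assume dim: "covering_dim_le X (-1)"
  have "{topspace X} \<in> open_covers X" by (simp add: open_covers_def)
  then obtain \<V> where \<V>: "\<V> \<in> open_covers X" "finite \<V>"
      "\<forall>x\<in>topspace X. int (card {V \<in> \<V>. x \<in> V}) \<le> -1 + 1"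
    using dim unfolding covering_dim_le_def by (metis finite.emptyI finite.insertI)
  show "topspace X = {}"
  proof (rule ccontr)
    assume "topspace X \<noteq> {}"
    then obtain x where x: "x \<in> topspace X" by blast
    then have "{V \<in> \<V>. x \<in> V} = {}" using \<V>(2,3) by fastforce
    moreover have "x \<in> \<Union>\<V>" using x \<V>(1) by (auto simp: open_covers_def)
    ultimately show False by blast
  qed
next
  assume "topspace X = {}"
  then show "covering_dim_le X (-1)"
    unfolding covering_dim_le_def refines_def by auto
qed

section \<open>A strategy for TWO from a countable decomposition\<close>

text \<open>Inning \<open>n\<close> is devoted to the \<open>n\<close>-th set of an enumeration,
  whatever happened before; after \<omega> innings every set has been covered.\<close>

lemma TWO_wins_if_countable_union:
  assumes "countable \<Z>" and "\<Union>\<Z> = topspace X"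
    and "\<And>Z \<U>. Z \<in> \<Z> \<Longrightarrow> \<U> \<in> open_covers X \<Longrightarrow>
           \<exists>\<T>. (\<forall>T\<in>\<T>. openin X T) \<and> pairwise disjnt \<T> \<and> refines \<T> \<U> \<and> Z \<subseteq> \<Union>\<T>"
  shows "TWO_has_winning_strategy_Gc (open_covers X) (open_covers X)"
proof -
  \<comment> \<open>Adding the empty set makes the family nonempty, hence enumerable.\<close>
  define e where "e = from_nat_into (insert {} \<Z>)"
  have e_range: "range e = insert {} \<Z>"
    unfolding e_def using assms(1) by (intro range_from_nat_into) auto
  have "\<exists>\<T>. (\<forall>T\<in>\<T>. openin X T) \<and> pairwise disjnt \<T> \<and> refines \<T> \<U> \<and> e n \<subseteq> \<Union>\<T>"
    if "\<U> \<in> open_covers X" for n \<U>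
  proof (cases "e n = {}")
    \<comment> \<open>The added empty set may lie outside \<open>\<Z>\<close>, where the hypothesis
      says nothing; the empty family serves it.\<close>
    case True
    then show ?thesis by (intro exI[of _ "{}"]) (auto simp: refines_def)
  next
    case False
    then have "e n \<in> \<Z>" using e_range by (metis insertE rangeI)
    then show ?thesis using assms(3) that by simp
  qed
  then have "\<forall>n. \<forall>\<U>\<in>open_covers X. \<exists>\<T>.
      (\<forall>T\<in>\<T>. openin X T) \<and> pairwise disjnt \<T> \<and> refines \<T> \<U> \<and> e n \<subseteq> \<Union>\<T>"
    by blast
  then obtain t where "\<forall>n. \<forall>\<U>\<in>open_covers X.
      (\<forall>T\<in>t n \<U>. openin X T) \<and> pairwise disjnt (t n \<U>) \<and> refines (t n \<U>) \<U> \<and> e n \<subseteq> \<Union>(t n \<U>)"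
    unfolding bchoice_iff choice_iff by (elim exE)
  then have t: "\<forall>T\<in>t n \<U>. openin X T" "pairwise disjnt (t n \<U>)" "refines (t n \<U>) \<U>" "e n \<subseteq> \<Union>(t n \<U>)"
    if "\<U> \<in> open_covers X" for n \<U>
    using that by blast+
  \<comment> \<open>In inning \<open>l\<close> the history has length \<open>l + 1\<close>, so
    \<open>length L - 1\<close> recovers the inning and \<open>last L\<close> is ONE's current
    cover.\<close>
  define \<sigma> where "\<sigma> L = t (length L - 1) (last L)" for L
  have \<sigma>: "\<sigma> (map \<O> [0..<Suc l]) = t l (\<O> l)" for \<O> l
    by (simp add: \<sigma>_def)
  have "Gc_winning_strategy_TWO (open_covers X) (open_covers X) \<sigma>"
    unfolding Gc_winning_strategy_TWO_def Let_def \<sigma>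
  proof (intro allI impI conjI)
    fix \<O> :: "nat \<Rightarrow> 'a set set" assume \<O>: "\<forall>l. \<O> l \<in> open_covers X"
    show "Gc_legal_response (\<O> l) (t l (\<O> l))" for l
      using t \<O> by (simp add: Gc_legal_response_def)
    have op: "openin X T" if "T \<in> t l (\<O> l)" for T l using t(1) \<O> that by blast
    have "topspace X \<subseteq> \<Union>(\<Union>l. t l (\<O> l))"
    proof
      fix x assume "x \<in> topspace X"
      then have "x \<in> \<Union>(range e)" using assms(2) e_range by auto
      then obtain n where "x \<in> e n" by blast
      then show "x \<in> \<Union>(\<Union>l. t l (\<O> l))" using t(4)[of "\<O> n" n] \<O> by blast
    qed
    moreover have "\<Union>(\<Union>l. t l (\<O> l)) \<subseteq> topspace X" using op openin_subset by fast
    ultimately show "Gc_won_by_TWO (open_covers X) (\<lambda>l. t l (\<O> l))"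
      using op by (auto simp: Gc_won_by_TWO_def open_covers_def)
  qed
  then show ?thesis by (auto simp: TWO_has_winning_strategy_Gc_def)
qed

section \<open>Countable dimension from a winning strategy\<close>

text \<open>Winning is stated for infinite plays, so the position \<open>L\<close> is continued by
  repeating its last move. TWO's answer is open because the union over the whole play is an open
  cover.\<close>

lemma Gc_winning_strategy_TWO_position:
  assumes "Gc_winning_strategy_TWO \<A> (open_covers X) \<sigma>" "set L \<subseteq> \<A>" "L \<noteq> []"
  shows "Gc_legal_response (last L) (\<sigma> L)" and "\<And>T. T \<in> \<sigma> L \<Longrightarrow> openin X T"
proof -
  define \<O> where "\<O> l = (if l < length L then L ! l else last L)" for l
  obtain k where k: "length L = Suc k" using assms(3) by (cases L) auto
  have "\<forall>l. \<O> l \<in> \<A>" using assms(2,3) last_in_set[of L] nth_mem[of _ L] unfolding \<O>_def by auto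
  moreover have "map \<O> [0..<Suc k] = L"
    by (rule nth_equalityI) (auto simp: k \<O>_def simp del: upt_Suc)
  moreover have "\<O> k = last L" using assms(3) k by (simp add: \<O>_def last_conv_nth)
  ultimately have leg: "Gc_legal_response (last L) (\<sigma> L)"
    and won: "(\<Union>l. \<sigma> (map \<O> [0..<Suc l])) \<in> open_covers X"
    and sub: "\<sigma> L \<subseteq> (\<Union>l. \<sigma> (map \<O> [0..<Suc l]))"
    using assms(1) unfolding Gc_winning_strategy_TWO_def Let_def Gc_won_by_TWO_def
    by (metis, metis, metis UNIV_I UN_upper)
  show "Gc_legal_response (last L) (\<sigma> L)" by (rule leg)
  show "openin X T" if "T \<in> \<sigma> L" for T
    using won subsetD[OF sub that] by (auto simp: open_covers_def simp del: upt_Suc)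
qed

text \<open>Otherwise every \<open>s\<close> has a next index \<open>f s\<close> for which TWO's
  answer misses \<open>x\<close>. Following \<open>f\<close> from the empty sequence, ONE produces a
  play that never covers \<open>x\<close>.\<close>

lemma Gc_winning_strategy_TWO_catches_point:
  assumes win: "Gc_winning_strategy_TWO \<A> (open_covers X) \<sigma>" and B: "\<And>n. B n \<in> \<A>" and x: "x \<in> topspace X"
  shows "\<exists>s :: nat list. \<forall>n. x \<in> \<Union>(\<sigma> (map B (s @ [n])))"
proof (rule ccontr)
  assume "\<not> ?thesis"
  then obtain f where f: "\<And>s. x \<notin> \<Union>(\<sigma> (map B (s @ [f s])))" by metis
  \<comment> \<open>\<open>L k\<close> lists the first \<open>k\<close> indices and
    \<open>a k\<close> is the next one, so ONE's moves up to inning \<open>l\<close> are those of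
    \<open>L l @ [f (L l)]\<close>.\<close>
  define L where "L = rec_nat [] (\<lambda>_ s. s @ [f s])"
  define a where "a k = f (L k)" for k
  have L: "L k = map a [0..<k]" for k by (induction k) (simp_all add: L_def a_def)
  have play: "map (\<lambda>l. B (a l)) [0..<Suc l] = map B (L l @ [f (L l)])" for l
    by (simp add: L a_def comp_def)
  have "(\<Union>l. \<sigma> (map (\<lambda>l. B (a l)) [0..<Suc l])) \<in> open_covers X"
    using win[unfolded Gc_winning_strategy_TWO_def, rule_format, of "\<lambda>l. B (a l)"] B
    unfolding Let_def Gc_won_by_TWO_def by simp
  then have "x \<in> \<Union>(\<Union>l. \<sigma> (map B (L l @ [f (L l)])))"
    using x unfolding play open_covers_def by simp
  then obtain l where "x \<in> \<Union>(\<sigma> (map B (L l @ [f (L l)])))" by blast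
  then show False using f[of "L l"] by contradiction
qed

lemma (in Metric_space) countable_dimensional_if_TWO_wins:
  assumes "TWO_has_winning_strategy_Gc (open_covers mtopology) (open_covers mtopology)"
  shows "countable_dimensional mtopology"
proof -
  obtain \<sigma> where win: "Gc_winning_strategy_TWO (open_covers mtopology) (open_covers mtopology) \<sigma>"
    using assms by (auto simp: TWO_has_winning_strategy_Gc_def)
  \<comment> \<open>With ONE restricted to a sequence of covers, positions are lists of naturals, so
    there are only countably many sets \<open>C s\<close>.\<close>
  define B where "B n = (\<lambda>x. mball x (inverse (real (Suc n)))) ` M" for n
  have B: "B n \<in> open_covers mtopology" for n
    by (auto simp: B_def open_covers_def)
  \<comment> \<open>Intersecting over all next moves \<open>n\<close> lets one position
    \<open>s\<close> provide disjoint covers of \<open>C s\<close> at every scale.\<close>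
  define C where "C s = M \<inter> (\<Inter>n. \<Union>(\<sigma> (map B (s @ [n]))))" for s
  have cov: "\<Union>(range C) = M"
    using Gc_winning_strategy_TWO_catches_point[where B = B, OF win B] by (fastforce simp: C_def)
  have "covering_dim_le (subtopology mtopology (C s)) 0" for s
  proof (rule covering_dim_le_0_subspace_if_fine_disjoint_open_families)
    show "C s \<subseteq> M" by (auto simp: C_def)
    fix e :: real assume "e > 0"
    \<comment> \<open>Two points of one ball are closer than twice its radius, hence
      \<open>e / 2\<close>.\<close>
    then obtain n where n: "inverse (real (Suc n)) < e / 2"
      using reals_Archimedean[of "e / 2"] by auto
    let ?L = "map B (s @ [n])"
    have L: "set ?L \<subseteq> open_covers mtopology" "?L \<noteq> []" using B by auto
    note pos = Gc_winning_strategy_TWO_position[OF win L]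
    have leg: "pairwise disjnt (\<sigma> ?L)" "refines (\<sigma> ?L) (B n)"
      using pos(1) by (auto simp: Gc_legal_response_def)
    have "d x y < e" if "P \<in> \<sigma> ?L" "x \<in> P" "y \<in> P" for P x y
    proof -
      obtain c where "P \<subseteq> mball c (inverse (real (Suc n)))"
        using leg(2) \<open>P \<in> \<sigma> ?L\<close> by (auto simp: refines_def B_def)
      then have "x \<in> mball c (inverse (real (Suc n)))" "y \<in> mball c (inverse (real (Suc n)))"
        using that by auto
      then show ?thesis using n triangle[of x c y] commute[of x c] by auto
    qed
    moreover have "C s \<subseteq> \<Union>(\<sigma> ?L)" unfolding C_def by blast
    ultimately show "\<exists>\<P>. (\<forall>P\<in>\<P>. openin mtopology P) \<and> C s \<subseteq> \<Union>\<P> \<and> pairwise disjnt \<P> \<and>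
        (\<forall>P\<in>\<P>. \<forall>x\<in>P. \<forall>y\<in>P. d x y < e)"
      using pos(2) leg(1) by (intro exI[of _ "\<sigma> ?L"] conjI ballI)
  qed
  then have "zero_dimensional (subtopology mtopology (C s))" if "C s \<noteq> {}" for s
    using that by (auto simp: zero_dimensional_def covering_dim_le_minus_one_iff C_def)
  \<comment> \<open>An empty \<open>C s\<close> is not \<open>zero_dimensional\<close>; discarding
    it leaves the union unchanged.\<close>
  then show ?thesis
    unfolding countable_dimensional_def using cov
    by (intro exI[of _ "range C - {{}}"]) auto
qed

theorem theorem4p1:
  fixes M :: "'a set" and d :: "'a \<Rightarrow> 'a \<Rightarrow> real"
  assumes "Metric_space M d"
  defines "X \<equiv> Metric_space.mtopology M d"
  shows "(countable_dimensional X \<longrightarrow>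
            TWO_has_winning_strategy_Gc (open_covers X) (open_covers X)) \<and>
         (TWO_has_winning_strategy_Gc (open_covers X) (open_covers X) \<longrightarrow>
            countable_dimensional X)"
proof -
  interpret Metric_space M d by fact
  show ?thesis unfolding X_def
  proof (intro conjI impI countable_dimensional_if_TWO_wins)
    assume "countable_dimensional mtopology"
    then obtain \<Z> where \<Z>: "countable \<Z>" "\<Union>\<Z> = topspace mtopology"
      "\<And>Z. Z \<in> \<Z> \<Longrightarrow> Z \<subseteq> M \<and> covering_dim_le (subtopology mtopology Z) 0"
      by (auto simp: countable_dimensional_def zero_dimensional_def)
    show "TWO_has_winning_strategy_Gc (open_covers mtopology) (open_covers mtopology)"
    proof (rule TWO_wins_if_countable_union[OF \<Z>(1,2)])
      fix Z \<U> assume Z: "Z \<in> \<Z>" and \<U>: "\<U> \<in> open_covers mtopology"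
      show "\<exists>\<T>. (\<forall>T\<in>\<T>. openin mtopology T) \<and> pairwise disjnt \<T> \<and> refines \<T> \<U> \<and> Z \<subseteq> \<Union>\<T>"
        using disjoint_open_refinement_covering_subspace[OF _ _ \<U>] \<Z>(3)[OF Z] by metis
    qed
  qed
qed

end
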